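(* Every (finite) tree is $132$-representable by a $2$-uniform word, i.e., for some labeling of its vertices by distinct elements of a totally ordered set it is represented by a $132$-avoiding word in which every letter occurs exactly twice.
   Context: A word is a finite sequence of letters from a totally ordered alphabet. Two letters $x,y$ alternate in a word $w$ if between any two occurrences of $x$ there is an occurrence of $y$ and between any two occurrences of $y$ there is an occurrence of $x$. A graph $G=(V,E)$ is represented by a word $w$ over $V$ if for all distinct $x,y\in V$, $x$ and $y$ alternate in $w$ if and only if $xy\in E$. A word $w_1\cdots w_n$ contains the pattern $132$ if there are indices $i<j<l$ with $w_i<w_l<w_j$, and is $132$-avoiding otherwise. *)

theory Defs
  imports "Graph_Theory.Graph_Theory"
begin

(* The locale graph of Graph_Theory describes finite simple graphs, as symmetric loop-free
   digraphs without parallel arcs; u and v are adjacent iff u \<rightarrow>\<^bsub>G\<^esub> v. In such a digraph the two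
   arcs of an edge form a cycle of length 2, so the predicate tree of Graph_Theory does not
   describe undirected trees. The cycles of an undirected graph are those of length at least 3.
   A connected graph is nonempty. *)

definition undirected_tree :: "('a, 'b) pre_digraph \<Rightarrow> bool" where
  "undirected_tree G \<longleftrightarrow>
     graph G \<and> connected G \<and> \<not> (\<exists>p. pre_digraph.cycle G p \<and> 3 \<le> length p)"

definition relabel :: "('a \<Rightarrow> 'l) \<Rightarrow> ('a, 'b) pre_digraph \<Rightarrow> ('l, 'b) pre_digraph" where
  "relabel lab G =
     \<lparr>verts = lab ` verts G, arcs = arcs G, tail = lab \<circ> tail G, head = lab \<circ> head G\<rparr>"

definition occurs_between :: "'a list \<Rightarrow> 'a \<Rightarrow> 'a \<Rightarrow> bool" where
  "occurs_between w x y \<longleftrightarrow>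
     (\<forall>i j. i < j \<and> j < length w \<and> w ! i = x \<and> w ! j = x \<longrightarrow> (\<exists>k. i < k \<and> k < j \<and> w ! k = y))"

definition alternate :: "'a list \<Rightarrow> 'a \<Rightarrow> 'a \<Rightarrow> bool" where
  "alternate w x y \<longleftrightarrow> occurs_between w x y \<and> occurs_between w y x"

(* As usual for word-representable graphs, every vertex has to occur in the word. *)

definition represents :: "'a list \<Rightarrow> ('a, 'b) pre_digraph \<Rightarrow> bool" where
  "represents w G \<longleftrightarrow>
     set w = verts G \<and>
     (\<forall>x\<in>verts G. \<forall>y\<in>verts G. x \<noteq> y \<longrightarrow> (alternate w x y \<longleftrightarrow> x \<rightarrow>\<^bsub>G\<^esub> y))"

definition uniform_word :: "nat \<Rightarrow> 'a list \<Rightarrow> bool" where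
  "uniform_word k w \<longleftrightarrow> (\<forall>x\<in>set w. count_list w x = k)"

definition contains_132 :: "'a::linorder list \<Rightarrow> bool" where
  "contains_132 w \<longleftrightarrow>
     (\<exists>i j l. i < j \<and> j < l \<and> l < length w \<and> w ! i < w ! l \<and> w ! l < w ! j)"

end

theory Submission
  imports Defs
begin

text \<open>
  A tree is built from single vertices by joining a tree with root r and a disjoint tree with
  root a along the edge ra, keeping r as the root. The word of a rooted tree ends with its root,
  which carries the smallest label. If the two trees have the words u r and v a, then their
  join has the word v u a r, where all labels of the second tree are shifted above those of the
  first. Moving the a past u r changes no alternation inside either tree. A letter of v other
  than a has both occurrences before all letters of u, and u contains r once and every other
  vertex of the first tree twice, so between the two trees only a and r alternate. As the labels
  of v are above those of u and r, and r is the minimum, no 132 pattern arises.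

  Every undirected tree G is built in this way. Take a maximal induced subgraph of G that is so
  built. A vertex outside it with exactly one neighbour inside could be added as a leaf, and one
  with two neighbours inside would close a cycle, so by connectedness the subgraph is G.
\<close>

section \<open>Alternation read off the restriction of a word to two letters\<close>

lemma occurrences_preceded_iff:
  assumes "x \<noteq> y"
  shows "(\<forall>j<length w. w ! j = x \<longrightarrow> (\<exists>k<j. w ! k = y)) \<longleftrightarrow>
    filter (\<lambda>z. z = x \<or> z = y) w = [] \<or> hd (filter (\<lambda>z. z = x \<or> z = y) w) \<noteq> x"
  using assms by (induction w) (auto simp: All_less_Suc2 Ex_less_Suc2)

lemma occurs_between_Nil [simp]: "occurs_between [] x y"
  by (simp add: occurs_between_def)

text \<open>Prepending c creates new pairs of occurrences of x only if c = x, and these start at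
  position 0. The new condition speaks of every later occurrence, so that
  \<open>occurrences_preceded_iff\<close> turns it into a condition on the head of the two-letter
  restriction.\<close>

lemma occurs_between_Cons:
  "occurs_between (c # w) x y \<longleftrightarrow>
    occurs_between w x y \<and> (c = x \<longrightarrow> (\<forall>j<length w. w ! j = x \<longrightarrow> (\<exists>k<j. w ! k = y)))"
  (is "?L \<longleftrightarrow> ?R")
proof
  assume L: ?L
  show ?R
    unfolding occurs_between_def
  proof (intro conjI allI impI)
    fix i j assume "i < j \<and> j < length w \<and> w ! i = x \<and> w ! j = x"
    with L[unfolded occurs_between_def, rule_format, of "Suc i" "Suc j"]
    obtain k where "Suc i < k" "k < Suc j" "(c # w) ! k = y" by auto
    then show "\<exists>k>i. k < j \<and> w ! k = y"
      by (intro exI[of _ "k - 1"]) (auto simp: nth_Cons')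
  next
    fix j assume "c = x" "j < length w" "w ! j = x"
    with L[unfolded occurs_between_def, rule_format, of 0 "Suc j"]
    obtain k where "0 < k" "k < Suc j" "(c # w) ! k = y" by auto
    then show "\<exists>k<j. w ! k = y"
      by (intro exI[of _ "k - 1"]) (auto simp: nth_Cons')
  qed
next
  assume R: ?R
  show ?L
    unfolding occurs_between_def
  proof (intro allI impI)
    fix i j assume ij: "i < j \<and> j < length (c # w) \<and> (c # w) ! i = x \<and> (c # w) ! j = x"
    then obtain j' where j': "j = Suc j'" by (cases j) auto
    show "\<exists>k>i. k < j \<and> (c # w) ! k = y"
    proof (cases i)
      case 0
      with ij j' R obtain k where "k < j'" "w ! k = y" by auto
      with 0 j' show ?thesis by (intro exI[of _ "Suc k"]) auto
    next
      case (Suc i')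
      moreover from R have "\<exists>k>i'. k < j' \<and> w ! k = y"
        using ij j' Suc by (intro R[THEN conjunct1, unfolded occurs_between_def, rule_format]) auto
      then obtain k where "i' < k" "k < j'" "w ! k = y" by blast
      ultimately show ?thesis using j' by (intro exI[of _ "Suc k"]) auto
    qed
  qed
qed

text \<open>Two occurrences of one letter with no occurrence of the other between them yield equal
  neighbours once all other letters are deleted. Alternation in a concatenation can thus be computed
  with \<open>filter\<close>.\<close>

lemma alternate_iff_distinct_adj:
  assumes "x \<noteq> y"
  shows "alternate w x y \<longleftrightarrow> distinct_adj (filter (\<lambda>z. z = x \<or> z = y) w)"
proof (induction w)
  case Nil
  show ?case by (simp add: alternate_def)
next
  case (Cons c w)
  have "(\<forall>j<length w. w ! j = y \<longrightarrow> (\<exists>k<j. w ! k = x)) \<longleftrightarrow>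
      filter (\<lambda>z. z = x \<or> z = y) w = [] \<or> hd (filter (\<lambda>z. z = x \<or> z = y) w) \<noteq> y"
    using occurrences_preceded_iff[of y x w] assms by (simp add: disj_commute)
  with Cons show ?case
    using occurrences_preceded_iff[OF assms, of w] assms
    by (auto simp: alternate_def occurs_between_Cons distinct_adj_Cons)
qed

lemma alternate_commute: "alternate w x y \<longleftrightarrow> alternate w y x"
  by (auto simp: alternate_def)

lemma alternate_map:
  assumes "inj_on f (set w)" "x \<in> set w" "y \<in> set w" "x \<noteq> y"
  shows "alternate (map f w) (f x) (f y) \<longleftrightarrow> alternate w x y"
proof -
  let ?v = "filter (\<lambda>z. z = x \<or> z = y) w"
  have "filter (\<lambda>z. z = f x \<or> z = f y) (map f w) = map f ?v"
    using assms unfolding filter_map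
    by (intro arg_cong[of _ _ "map f"] filter_cong) (auto simp: inj_on_eq_iff)
  moreover have "inj_on f (set ?v)"
    using assms(1) by (rule inj_on_subset) auto
  moreover have "f x \<noteq> f y"
    using assms by (auto simp: inj_on_eq_iff)
  ultimately show ?thesis
    using assms(4) by (simp add: alternate_iff_distinct_adj distinct_adj_map_iff)
qed

section \<open>Avoidance of 132, letter by letter\<close>

fun avoids_132 :: "'a::linorder list \<Rightarrow> bool" where
  "avoids_132 [] \<longleftrightarrow> True"
| "avoids_132 (x # xs) \<longleftrightarrow> sorted (filter ((<) x) xs) \<and> avoids_132 xs"

lemma sorted_filter_nth:
  assumes "sorted (filter P xs)" "i < j" "j < length xs" "P (xs ! i)" "P (xs ! j)"
  shows "xs ! i \<le> xs ! j"
  using assms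
proof (induction xs arbitrary: i j)
  case (Cons x xs)
  then show ?case by (cases i; cases j) (auto split: if_splits)
qed simp

text \<open>In the recursion the head takes the role of the smallest letter of a pattern, and the
  larger letters after it must not descend. Sortedness is weak, so the second copy of a letter does
  no harm.\<close>

lemma avoids_132_imp_not_contains:
  assumes "avoids_132 w"
  shows "\<not> contains_132 w"
proof
  assume "contains_132 w"
  then obtain i j l where "i < j" "j < l" "l < length w" "w ! i < w ! l" "w ! l < w ! j"
    by (auto simp: contains_132_def)
  with assms show False
  proof (induction w arbitrary: i j l)
    case (Cons x w)
    obtain j' l' where jl: "j = Suc j'" "l = Suc l'"
      using Cons.prems by (cases j; cases l) auto
    show ?case
    proof (cases i)
      case 0
      with Cons.prems jl have "w ! j' \<le> w ! l'"
        by (intro sorted_filter_nth[of "(<) x"]) auto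
      with Cons.prems jl show ?thesis by auto
    next
      case (Suc i')
      with Cons jl show ?thesis by (intro Cons.IH[of i' j' l']) auto
    qed
  qed simp
qed

text \<open>This allows the labels of one tree to be shifted by a constant.\<close>

lemma avoids_132_cong_order:
  assumes "\<And>x y. x \<in> set w \<Longrightarrow> y \<in> set w \<Longrightarrow> f x < f y \<longleftrightarrow> g x < g y"
  shows "avoids_132 (map f w) \<longleftrightarrow> avoids_132 (map g w)"
  using assms
proof (induction w)
  case (Cons x w)
  have "filter ((<) (f x) \<circ> f) w = filter ((<) (g x) \<circ> g) w"
    using Cons.prems by (intro filter_cong) auto
  moreover have "sorted (map f v) \<longleftrightarrow> sorted (map g v)" if "set v \<subseteq> set w" for v
    using that Cons.prems by (induction v) (auto simp flip: not_less)
  ultimately show ?case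
    using Cons by (simp add: filter_map)
qed simp

text \<open>No letter of ys or zs exceeds a letter of xs. For a pattern starting in xs, the
  remaining letters therefore come from xs or are a, as in \<open>xs @ [a]\<close>.\<close>

lemma avoids_132_insert_above:
  assumes "avoids_132 (xs @ [a])" "avoids_132 (ys @ a # zs)"
    and "\<And>x y. x \<in> set xs \<Longrightarrow> y \<in> set (ys @ zs) \<Longrightarrow> y \<le> x"
  shows "avoids_132 (xs @ ys @ a # zs)"
  using assms
proof (induction xs)
  case (Cons x xs)
  have "y \<le> x" if "y \<in> set (ys @ zs)" for y
    using that by (intro Cons.prems(3)) auto
  then have "filter ((<) x) ys = []" "filter ((<) x) zs = []"
    by (auto simp: filter_empty_conv not_less)
  then have "filter ((<) x) (xs @ ys @ a # zs) = filter ((<) x) (xs @ [a])" by simp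
  with Cons show ?case by simp
qed simp

text \<open>The new letter a could only be the largest of a pattern, but the sole letter after it is
  r, which exceeds no letter of ys. In the recursion, each list of larger letters gains at most a
  maximum at its end.\<close>

lemma avoids_132_insert_max:
  assumes "avoids_132 (ys @ [r])" "r \<le> a"
    and "\<And>y. y \<in> set ys \<Longrightarrow> r \<le> y \<and> y \<le> a"
  shows "avoids_132 (ys @ [a, r])"
  using assms
proof (induction ys)
  case (Cons y ys)
  have "r \<le> y" "\<forall>z\<in>set ys. z \<le> a"
    using Cons.prems(3) by auto
  moreover have "avoids_132 (ys @ [a, r])"
    using Cons by simp
  ultimately show ?case
    using Cons.prems(1) by (auto simp: sorted_append)
qed auto

section \<open>Rooted trees and their words\<close>

inductive rooted_tree :: "'a set \<Rightarrow> 'a rel \<Rightarrow> 'a \<Rightarrow> bool" where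
  single: "rooted_tree {r} {} r"
| join: "\<lbrakk>rooted_tree V E r; rooted_tree W F a; V \<inter> W = {}\<rbrakk>
    \<Longrightarrow> rooted_tree (V \<union> W) (E \<union> F \<union> {(r, a), (a, r)}) r"

lemma rooted_tree_facts:
  assumes "rooted_tree V E r"
  shows "finite V" "r \<in> V" "E \<subseteq> V \<times> V" "sym E"
  using assms by (induction rule: rooted_tree.induct) (auto simp: sym_def)

text \<open>The leaf may hang at any vertex v. The induction descends into the part that contains v
  until v is a single vertex, where adding the leaf is a join of two singletons.\<close>

lemma rooted_tree_add_leaf:
  assumes "rooted_tree V E r" "v \<in> V" "l \<notin> V"
  shows "rooted_tree (insert l V) (E \<union> {(v, l), (l, v)}) r"
  using assms
proof (induction rule: rooted_tree.induct)
  case (single r)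
  then show ?case
    using rooted_tree.join[OF rooted_tree.single rooted_tree.single, of r l]
    by (simp add: insert_commute)
next
  case (join V E r W F a)
  show ?case
  proof (cases "v \<in> V")
    case True
    with join have "rooted_tree (insert l V \<union> W)
        ((E \<union> {(v, l), (l, v)}) \<union> F \<union> {(r, a), (a, r)}) r"
      by (intro rooted_tree.join) auto
    then show ?thesis by (simp add: Un_ac insert_commute)
  next
    case False
    with join have "rooted_tree (V \<union> insert l W)
        (E \<union> (F \<union> {(v, l), (l, v)}) \<union> {(r, a), (a, r)}) r"
      by (intro rooted_tree.join) auto
    then show ?thesis by (simp add: Un_ac insert_commute)
  qed
qed

text \<open>Every vertex reaches the root, and the edge relation is symmetric.\<close>

lemma rooted_tree_connected:
  assumes "rooted_tree V E r" "u \<in> V" "v \<in> V"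
  shows "(u, v) \<in> E\<^sup>*"
proof -
  have to_root: "(x, r) \<in> E\<^sup>*" if "x \<in> V" for x
    using assms(1) that
  proof (induction rule: rooted_tree.induct)
    case (join V E r W F a)
    let ?E = "E \<union> F \<union> {(r, a), (a, r)}"
    show ?case
    proof (cases "x \<in> V")
      case True
      with join have "(x, r) \<in> E\<^sup>*" by simp
      then show ?thesis by (rule rtrancl_mono[THEN subsetD, rotated]) auto
    next
      case False
      with join have "(x, a) \<in> F\<^sup>*" by simp
      then have "(x, a) \<in> ?E\<^sup>*" by (rule rtrancl_mono[THEN subsetD, rotated]) auto
      then show ?thesis by (rule rtrancl_into_rtrancl) simp
    qed
  qed simp
  have "(r, v) \<in> E\<^sup>*"
    using to_root[OF assms(3)] rooted_tree_facts(4)[OF assms(1)] by (meson sym_rtrancl symD)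
  with to_root[OF assms(2)] show ?thesis by (rule rtrancl_trans)
qed

text \<open>The full word is \<open>u @ [r]\<close>. Its last letter is kept apart because a join
  inserts a letter just before it. The word consists of vertices, and lab only supplies their
  order.\<close>

definition tree_word :: "'a set \<Rightarrow> 'a rel \<Rightarrow> 'a \<Rightarrow> ('a \<Rightarrow> nat) \<Rightarrow> 'a list \<Rightarrow> bool" where
  "tree_word V E r lab u \<longleftrightarrow>
     inj_on lab V \<and> (\<forall>x\<in>V. lab r \<le> lab x) \<and> avoids_132 (map lab (u @ [r])) \<and>
     set u = V \<and> (\<forall>x\<in>V. count_list (u @ [r]) x = 2) \<and>
     (\<forall>x\<in>V. \<forall>y\<in>V. x \<noteq> y \<longrightarrow> (alternate (u @ [r]) x y \<longleftrightarrow> (x, y) \<in> E))"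

lemma filter_two_absent:
  assumes "x \<notin> set w"
  shows "filter (\<lambda>z. z = x \<or> z = y) w = replicate (count_list w y) y"
  using assms by (induction w) auto

lemma tree_word_join:
  assumes T: "rooted_tree V E r" "rooted_tree W F a" "V \<inter> W = {}"
    and u: "tree_word V E r l u" and v: "tree_word W F a m v"
  shows "\<exists>lab. tree_word (V \<union> W) (E \<union> F \<union> {(r, a), (a, r)}) r lab (v @ u @ [a])"
proof -
  note fV = rooted_tree_facts[OF T(1)] and fW = rooted_tree_facts[OF T(2)]
  \<comment> \<open>N exceeds all labels of the first tree, so adding it to the labels of the second
    tree lifts them above all those of the first and keeps r minimal.\<close>
  obtain N where N: "\<And>x. x \<in> V \<Longrightarrow> l x < N"
    using finite_nat_set_iff_bounded[of "l ` V"] fV(1) by auto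
  define lab where "lab x = (if x \<in> V then l x else m x + N)" for x
  have labV: "lab x = l x" if "x \<in> V" for x using that by (simp add: lab_def)
  have labW: "lab x = m x + N" if "x \<in> W" for x using that T(3) by (auto simp: lab_def)
  have lt: "lab x < lab y" if "x \<in> V" "y \<in> W" for x y
    using N[of x] that by (simp add: labV labW)
  have injV: "inj_on l V" and injW: "inj_on m W"
    and minV: "\<And>x. x \<in> V \<Longrightarrow> l r \<le> l x"
    and avoid: "avoids_132 (map l (u @ [r]))" "avoids_132 (map m (v @ [a]))"
    and set: "set u = V" "set v = W"
    and countV: "\<And>x. x \<in> V \<Longrightarrow> count_list (u @ [r]) x = 2"
    and countW: "\<And>x. x \<in> W \<Longrightarrow> count_list (v @ [a]) x = 2"
    and altV: "\<And>x y. \<lbrakk>x \<in> V; y \<in> V; x \<noteq> y\<rbrakk> \<Longrightarrow> alternate (u @ [r]) x y \<longleftrightarrow> (x, y) \<in> E"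
    and altW: "\<And>x y. \<lbrakk>x \<in> W; y \<in> W; x \<noteq> y\<rbrakk> \<Longrightarrow> alternate (v @ [a]) x y \<longleftrightarrow> (x, y) \<in> F"
    using u v unfolding tree_word_def by blast+
  have "inj_on lab (V \<union> W)"
  proof (rule inj_onI)
    fix x y assume xy: "x \<in> V \<union> W" "y \<in> V \<union> W" "lab x = lab y"
    then consider "x \<in> V" "y \<in> V" | "x \<in> W" "y \<in> W"
      using lt[of x y] lt[of y x] by auto
    then show "x = y"
    proof cases
      case 1
      with xy(3) injV show ?thesis by (simp add: labV inj_on_eq_iff)
    next
      case 2
      with xy(3) injW show ?thesis by (simp add: labW inj_on_eq_iff)
    qed
  qed
  moreover have min: "\<forall>x\<in>V \<union> W. lab r \<le> lab x"
  proof
    fix x assume "x \<in> V \<union> W"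
    then show "lab r \<le> lab x"
      using minV[of x] lt[of r x] fV(2) by (cases "x \<in> V") (simp_all add: labV)
  qed
  moreover have "avoids_132 (map lab ((v @ u @ [a]) @ [r]))"
  proof -
    have "map lab (u @ [r]) = map l (u @ [r])"
      using set fV(2) labV by auto
    then have "avoids_132 (map lab (u @ [r]))"
      using avoid(1) by (simp only:)
    then have "avoids_132 (map lab u @ [lab r])" by simp
    moreover have "avoids_132 (map lab (v @ [a])) \<longleftrightarrow> avoids_132 (map m (v @ [a]))"
      using set fW(2) by (intro avoids_132_cong_order) (auto simp: labW)
    with avoid(2) have "avoids_132 (map lab v @ [lab a])" by simp
    moreover from calculation(1) have "avoids_132 (map lab u @ [lab a, lab r])"
      using set lt fV(2) fW(2) min by (intro avoids_132_insert_max) (auto intro: less_imp_le)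
    moreover have "y \<le> x"
      if "x \<in> set (map lab v)" "y \<in> set (map lab u @ [lab r])" for x y
      using that set lt fV(2) by (auto intro: less_imp_le)
    ultimately show ?thesis
      using avoids_132_insert_above[of "map lab v" "lab a" "map lab u" "[lab r]"] by simp
  qed
  moreover have "set (v @ u @ [a]) = V \<union> W"
    using set fW(2) by auto
  moreover have "\<forall>x\<in>V \<union> W. count_list ((v @ u @ [a]) @ [r]) x = 2"
  proof
    fix x assume "x \<in> V \<union> W"
    then show "count_list ((v @ u @ [a]) @ [r]) x = 2"
    proof
      assume x: "x \<in> V"
      then have "x \<notin> set v" "x \<noteq> a" using T(3) set fW(2) by auto
      with countV[OF x] show ?thesis by (auto split: if_splits)
    next
      assume x: "x \<in> W"
      then have "x \<notin> set u" "x \<noteq> r" using T(3) set fV(2) by auto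
      with countW[OF x] show ?thesis by (auto split: if_splits)
    qed
  qed
  moreover have "alternate ((v @ u @ [a]) @ [r]) x y \<longleftrightarrow> (x, y) \<in> E \<union> F \<union> {(r, a), (a, r)}"
    if xy: "x \<in> V \<union> W" "y \<in> V \<union> W" "x \<noteq> y" for x y
  proof -
    let ?f = "filter (\<lambda>z. z = x \<or> z = y)"
    have V: ?thesis if "x \<in> V" "y \<in> V"
    proof -
      \<comment> \<open>Restricting to two vertices of one tree deletes the letters of the other
        tree, which leaves the restriction of u r here and of v a in the next case.\<close>
      have eq: "?f ((v @ u @ [a]) @ [r]) = ?f (u @ [r])"
        using that T(3) set fW(2) by (auto simp: filter_empty_conv)
      have "(x, y) \<notin> F \<union> {(r, a), (a, r)}"
        using that T(3) fW by auto
      then show ?thesis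
        using altV[OF that xy(3)] unfolding alternate_iff_distinct_adj[OF xy(3)] eq by blast
    qed
    have W: ?thesis if "x \<in> W" "y \<in> W"
    proof -
      have eq: "?f ((v @ u @ [a]) @ [r]) = ?f (v @ [a])"
        using that T(3) set fV(2) by (auto simp: filter_empty_conv)
      have "(x, y) \<notin> E \<union> {(r, a), (a, r)}"
        using that T(3) fV by auto
      then show ?thesis
        using altW[OF that xy(3)] unfolding alternate_iff_distinct_adj[OF xy(3)] eq by blast
    qed
    have VW: "alternate ((v @ u @ [a]) @ [r]) p q \<longleftrightarrow> p = r \<and> q = a"
      if pq: "p \<in> V" "q \<in> W" for p q
    proof -
      have ne: "p \<noteq> q" "p \<noteq> a" "q \<noteq> r" using pq T(3) fV(2) fW(2) by auto
      have cp: "count_list u p = (if p = r then 1 else 2)"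
        and cq: "count_list v q = (if q = a then 1 else 2)"
        using countV[OF pq(1)] countW[OF pq(2)] by (auto split: if_splits)
      \<comment> \<open>For p = r and q = a the restriction of the whole word is q p q p. If q
        differs from a, then v contributes q q, and if p differs from r, then u contributes p
        p.\<close>
      have "filter (\<lambda>z. z = p \<or> z = q) v = replicate (if q = a then 1 else 2) q"
        using pq T(3) set cq by (subst filter_two_absent) auto
      moreover have "filter (\<lambda>z. z = p \<or> z = q) u = replicate (if p = r then 1 else 2) p"
        using pq T(3) set cp filter_two_absent[of q u p] by (auto simp: disj_commute)
      ultimately show ?thesis
        using ne by (auto simp: alternate_iff_distinct_adj numeral_2_eq_2 distinct_adj_append_iff)
    qed
    have EF: "(p, q) \<notin> E \<union> F" "(q, p) \<notin> E \<union> F" if "p \<in> V" "q \<in> W" for p q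
      using that T(3) fV(3) fW(3) by auto
    consider "x \<in> V" "y \<in> V" | "x \<in> W" "y \<in> W" | "x \<in> V" "y \<in> W" | "x \<in> W" "y \<in> V"
      using xy by blast
    then show ?thesis
    proof cases
      case 3
      moreover from 3 have "x \<noteq> a" using T(3) fW(2) by auto
      ultimately show ?thesis using VW[of x y] EF(1)[of x y] by simp
    next
      case 4
      moreover from 4 have "x \<noteq> r" using T(3) fV(2) by auto
      ultimately show ?thesis
        using VW[of y x] EF(2)[of y x] by (subst alternate_commute) auto
    qed (fact V W)+
  qed
  ultimately have "tree_word (V \<union> W) (E \<union> F \<union> {(r, a), (a, r)}) r lab (v @ u @ [a])"
    unfolding tree_word_def by blast
  then show ?thesis by (rule exI[where x = lab])
qed

lemma rooted_tree_word:
  assumes "rooted_tree V E r"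
  shows "\<exists>lab u. tree_word V E r lab u"
  using assms
proof (induction rule: rooted_tree.induct)
  case (single r)
  \<comment> \<open>The full word of a single vertex is r r.\<close>
  have "tree_word {r} {} r (\<lambda>_. 0) [r]" by (simp add: tree_word_def)
  then show ?case by blast
next
  case (join V E r W F a)
  then obtain l u m v where "tree_word V E r l u" "tree_word W F a m v" by blast
  from tree_word_join[OF join.hyps(1-3) this] show ?case by blast
qed

section \<open>Undirected trees are rooted trees\<close>

lemma (in wf_digraph) rtrancl_imp_awalk_within:
  assumes "(u, v) \<in> (arcs_ends G \<inter> S \<times> S)\<^sup>*" "u \<in> verts G"
  shows "\<exists>p. awalk u p v \<and> tail G ` set p \<subseteq> S"
  using assms
proof (induction rule: converse_rtrancl_induct)
  case base
  then show ?case by (intro exI[of _ "[]"]) (simp add: awalk_Nil_iff)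
next
  case (step x y)
  then obtain e where e: "e \<in> arcs G" "tail G e = x" "head G e = y" "x \<in> S"
    by (auto simp: arcs_ends_def arc_to_ends_def)
  with step obtain p where "awalk y p v" "tail G ` set p \<subseteq> S" by auto
  with e show ?case by (intro exI[of _ "e # p"]) (auto simp: awalk_Cons_iff)
qed

text \<open>A path from u to v inside S is closed up through z. As u and v differ, the path has at
  least one arc, so the cycle has at least three and is not just an edge traversed back and
  forth.\<close>

lemma (in wf_digraph) cycle_through_outside:
  assumes S: "rooted_tree S (arcs_ends G \<inter> S \<times> S) r" "S \<subseteq> verts G"
    and "u \<in> S" "v \<in> S" "u \<noteq> v" "z \<notin> S" "(z, u) \<in> arcs_ends G" "(v, z) \<in> arcs_ends G"
  shows "\<exists>p. cycle p \<and> 3 \<le> length p"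
proof -
  obtain p where p: "awalk u p v" "tail G ` set p \<subseteq> S"
    using rtrancl_imp_awalk_within[OF rooted_tree_connected[OF S(1)], of u v] assms by auto
  \<comment> \<open>Shortening the walk to a path only drops arcs, so all tails remain in S.\<close>
  define q where "q = awalk_to_apath p"
  have q: "apath u q v" "tail G ` set q \<subseteq> S"
    using p awalk_to_apath_subset[OF p(1)] by (auto simp: q_def apath_awalk_to_apath)
  obtain e f where e: "e \<in> arcs G" "tail G e = z" "head G e = u"
    and f: "f \<in> arcs G" "tail G f = v" "head G f = z"
    using assms by (auto simp: arcs_ends_def arc_to_ends_def)
  have ne: "q \<noteq> []" using q(1) assms by (auto simp: apath_Nil_iff)
  have "awalk u q v" "distinct (awalk_verts u q)" using q by (auto simp: apath_def)
  then have dist: "distinct (map (tail G) q @ [v])"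
    using ne by (metis awalkE awalk_verts_conv last_snoc)
  have "awalk v [f] z" using f by (auto simp: awalk_Cons_iff awalk_Nil_iff)
  then have "awalk z (e # q @ [f]) z"
    using e \<open>awalk u q v\<close> by (auto simp: awalk_Cons_iff intro: awalk_appendI)
  \<comment> \<open>Without its first entry, the vertex list consists of the tails of q, then v,
    then z, and z lies outside S.\<close>
  moreover have "distinct (tl (awalk_verts z (e # q @ [f])))"
    using dist f q(2) assms by (auto simp: awalk_verts_conv)
  ultimately have "cycle (e # q @ [f])" by (auto simp: cycle_def)
  with ne show ?thesis by (intro exI[of _ "e # q @ [f]"]) (cases q; auto)
qed

lemma undirected_tree_imp_rooted_tree:
  assumes "undirected_tree G"
  shows "\<exists>r. rooted_tree (verts G) (arcs_ends G) r"
proof -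
  interpret graph G using assms by (simp add: undirected_tree_def)
  have conn: "strongly_connected (mk_symmetric G)"
    and acyclic: "\<not> (\<exists>p. cycle p \<and> 3 \<le> length p)"
    using assms by (simp_all add: undirected_tree_def connected_def)
  obtain r where r: "r \<in> verts G"
    using conn unfolding strongly_connected_def pverts_mk_symmetric with_proj_simps by blast
  \<comment> \<open>The root r can stay fixed, since leaves can be attached at any vertex.\<close>
  let ?P = "\<lambda>S. S \<subseteq> verts G \<and> rooted_tree S (arcs_ends G \<inter> S \<times> S) r"
  have loop: "(x, x) \<notin> arcs_ends G" for x
    using no_loops by (auto simp: arcs_ends_def arc_to_ends_def)
  have "arcs_ends G \<inter> {r} \<times> {r} = {}" using loop by auto
  then have "?P {r}" using r rooted_tree.single[of r] by simp
  define X where "X = {S. ?P S}"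
  have "finite X" by (rule finite_subset[of _ "Pow (verts G)"]) (auto simp: X_def)
  moreover have "X \<noteq> {}" using \<open>?P {r}\<close> unfolding X_def by blast
  ultimately obtain S where "S \<in> X" "\<forall>S'\<in>X. S \<subseteq> S' \<longrightarrow> S = S'"
    using finite_has_maximal[of X] by blast
  then have S: "?P S" and max: "\<And>S'. ?P S' \<Longrightarrow> S \<subseteq> S' \<Longrightarrow> S = S'"
    by (simp_all add: X_def)
  have "verts G \<subseteq> S"
  proof
    fix x assume "x \<in> verts G"
    with conn r have "r \<rightarrow>\<^sup>*\<^bsub>mk_symmetric G\<^esub> x"
      unfolding strongly_connected_def by simp
    then have "r \<rightarrow>\<^sup>*\<^bsub>G\<^esub> x" by (simp add: reachable_mk_symmetric_eq sym_arcs)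
    then have "(r, x) \<in> (arcs_ends G)\<^sup>*" by (rule reachable_rtranclI)
    \<comment> \<open>No step of a walk from r can leave S: the first vertex z outside S would
      enlarge S as a leaf.\<close>
    then show "x \<in> S"
    proof (induction rule: rtrancl_induct)
      case base
      show ?case using S rooted_tree_facts(2)[of S _ r] by blast
    next
      case (step y z)
      show ?case
      proof (rule ccontr)
        assume z: "z \<notin> S"
        have sub: "y' = y" if "y' \<in> S" "(y', z) \<in> arcs_ends G" for y'
        proof (rule ccontr)
          assume "y' \<noteq> y"
          then have "y \<noteq> y'" by simp
          with cycle_through_outside[OF _ _ step.IH that(1) _ z
              graph_symmetric[OF step.hyps(2)] that(2)] S acyclic
          show False by blast
        qed
        \<comment> \<open>As y is the only neighbour of z in S and z has no loop, passing to
          \<open>insert z S\<close> adds exactly the edge between y and z.\<close>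
        have "arcs_ends G \<inter> insert z S \<times> insert z S
            = (arcs_ends G \<inter> S \<times> S) \<union> {(y, z), (z, y)}"
          using sub z step.hyps(2) step.IH loop[of z] graph_symmetric[of z] graph_symmetric[of y z]
          by blast
        then have "?P (insert z S)"
          using rooted_tree_add_leaf[of S _ r y z] S z step.IH adj_in_verts(2)[OF step.hyps(2)]
          by simp
        with max z show False by blast
      qed
    qed
  qed
  with S have "S = verts G" by blast
  moreover have "arcs_ends G \<inter> verts G \<times> verts G = arcs_ends G"
    by (auto intro: adj_in_verts)
  ultimately have "rooted_tree (verts G) (arcs_ends G) r" using S by simp
  then show ?thesis ..
qed

section \<open>Passage from vertices to labels\<close>

lemma adj_relabel_iff:
  assumes "wf_digraph G" "inj_on lab (verts G)" "x \<in> verts G" "y \<in> verts G"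
  shows "lab x \<rightarrow>\<^bsub>relabel lab G\<^esub> lab y \<longleftrightarrow> x \<rightarrow>\<^bsub>G\<^esub> y"
proof -
  interpret wf_digraph G by fact
  have "lab (tail G e) = lab x \<longleftrightarrow> tail G e = x" "lab (head G e) = lab y \<longleftrightarrow> head G e = y"
    if "e \<in> arcs G" for e
    using that assms by (auto simp: inj_on_eq_iff)
  then show ?thesis
    by (force simp: arcs_ends_def arc_to_ends_def relabel_def)
qed

theorem theorem4p4:
  fixes G :: "('a, 'b) pre_digraph"
  assumes "undirected_tree G"
  shows "\<exists>(lab :: 'a \<Rightarrow> nat) (w :: nat list).
           inj_on lab (verts G) \<and>
           represents w (relabel lab G) \<and>
           uniform_word 2 w \<and>
           \<not> contains_132 w"
proof -
  interpret graph G using assms by (simp add: undirected_tree_def)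
  obtain r lab u where T: "rooted_tree (verts G) (arcs_ends G) r"
    and u: "tree_word (verts G) (arcs_ends G) r lab u"
    using undirected_tree_imp_rooted_tree[OF assms] rooted_tree_word by metis
  \<comment> \<open>Up to here the letters are vertices. Applying the injective lab preserves
    alternation and letter counts, and the avoidance in \<open>tree_word\<close> already concerns
    the labels.\<close>
  define w where "w = u @ [r]"
  have inj: "inj_on lab (verts G)" and set: "set w = verts G"
    and avoid: "avoids_132 (map lab w)"
    and count: "\<And>x. x \<in> verts G \<Longrightarrow> count_list w x = 2"
    and alt: "\<And>x y. \<lbrakk>x \<in> verts G; y \<in> verts G; x \<noteq> y\<rbrakk> \<Longrightarrow> alternate w x y \<longleftrightarrow> x \<rightarrow>\<^bsub>G\<^esub> y"
    using u rooted_tree_facts(2)[OF T] by (auto simp: tree_word_def w_def)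
  have "represents (map lab w) (relabel lab G)"
    unfolding represents_def
  proof (intro conjI ballI impI)
    show "set (map lab w) = verts (relabel lab G)" using set by (simp add: relabel_def)
  next
    fix p q
    assume "p \<in> verts (relabel lab G)" "q \<in> verts (relabel lab G)" "p \<noteq> q"
    then obtain x y where "x \<in> verts G" "y \<in> verts G" "x \<noteq> y" "p = lab x" "q = lab y"
      by (auto simp: relabel_def)
    then show "alternate (map lab w) p q \<longleftrightarrow> p \<rightarrow>\<^bsub>relabel lab G\<^esub> q"
      using alt inj set by (simp add: alternate_map adj_relabel_iff wf_digraph_axioms)
  qed
  moreover have "uniform_word 2 (map lab w)"
    unfolding uniform_word_def
  proof
    fix p assume "p \<in> set (map lab w)"
    then obtain x where x: "x \<in> set w" "p = lab x" by auto
    have "count_list (map lab w) (lab x) = count_list w x"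
      using inj set x by (intro count_list_inj_map) auto
    with x count set show "count_list (map lab w) p = 2" by simp
  qed
  ultimately show ?thesis
    using inj avoids_132_imp_not_contains[OF avoid] by blast
qed

end
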